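(* Let $\mathbf H_1,\mathbf G_1,\mathbf H_2,\mathbf G_2$ be finite digraphs with $\mathbf H_i\to\mathbf G_i$ for $i=1,2$, and let $\Lambda$ be a function from finite digraphs to finite digraphs which is a reduction from $\mathrm{PCSP}(\mathbf H_1,\mathbf G_1)$ to $\mathrm{PCSP}(\mathbf H_2,\mathbf G_2)$. Assume additionally that $\Lambda$ is monotone and preserves disjoint unions. Then there is a function $\Gamma$ from finite digraphs to (possibly infinite) digraphs such that for all finite digraphs $\mathbf H,\mathbf G$ we have $\mathbf H\to\Gamma\mathbf G$ if and only if $\Lambda\mathbf H\to\mathbf G$. Moreover, for any such $\Gamma$ we have $\mathbf H_1\to\Gamma\mathbf H_2$ and $\Gamma\mathbf G_2\to\mathbf G_1$.
   Context: Digraphs may have loops. A homomorphism $\mathbf H\to\mathbf G$ is a map $V(H)\to V(G)$ sending arcs to arcs; $\mathbf H\to\mathbf G$ means one exists. For digraphs $\mathbf H\to\mathbf G$, $\mathrm{PCSP}(\mathbf H,\mathbf G)$ is the promise decision problem: given a finite digraph $\mathbf I$ with either $\mathbf I\to\mathbf H$ or $\mathbf I\not\to\mathbf G$, output YES in the former case and NO in the latter. A function $\Lambda$ on finite digraphs is a reduction from $\mathrm{PCSP}(\mathbf H_1,\mathbf G_1)$ to $\mathrm{PCSP}(\mathbf H_2,\mathbf G_2)$ if for every finite digraph $\mathbf I$: $\mathbf I\to\mathbf H_1$ implies $\Lambda\mathbf I\to\mathbf H_2$, and $\mathbf I\not\to\mathbf G_1$ implies $\Lambda\mathbf I\not\to\mathbf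 G_2$. $\Lambda$ is monotone if $\mathbf H\to\mathbf G$ implies $\Lambda\mathbf H\to\Lambda\mathbf G$; it preserves disjoint unions if $\Lambda(\mathbf H_1+\mathbf H_2)$ and $\Lambda\mathbf H_1+\Lambda\mathbf H_2$ are homomorphically equivalent (each maps homomorphically to the other) for all digraphs $\mathbf H_1,\mathbf H_2$, where $+$ is disjoint union.
   Formalization: The equivalence "H → ΓG iff ΛH → G" is stated only for H with at least one vertex, since for empty H it fails (e.g. Λ constantly a single loop, G loopless); the moreover part accordingly assumes it only for nonempty H. *)

theory Defs
  imports "Graph_Theory.Pair_Digraph" "HOL-Library.Nat_Bijection"
begin

text \<open>
  A digraph (loops allowed, no parallel arcs) is a \<open>pair_pre_digraph\<close> satisfying
  \<open>pair_wf_digraph\<close>; a finite digraph is one satisfying \<open>pair_fin_digraph\<close>. Functions on the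
  class of finite digraphs are functions on digraphs with vertices in \<open>nat\<close>: every finite
  digraph is isomorphic to one of these. Only their values at finite digraphs matter.
\<close>

definition digraph_hom ::
  "'a pair_pre_digraph \<Rightarrow> 'b pair_pre_digraph \<Rightarrow> ('a \<Rightarrow> 'b) \<Rightarrow> bool" where
  "digraph_hom H G f \<longleftrightarrow>
     (\<forall>v\<in>pverts H. f v \<in> pverts G) \<and> (\<forall>(u, v)\<in>parcs H. (f u, f v) \<in> parcs G)"

definition maps_to :: "'a pair_pre_digraph \<Rightarrow> 'b pair_pre_digraph \<Rightarrow> bool"
    (infix \<open>\<rightharpoonup>\<close> 50) where
  "H \<rightharpoonup> G \<longleftrightarrow> (\<exists>f. digraph_hom H G f)"

definition hom_equivalent :: "'a pair_pre_digraph \<Rightarrow> 'b pair_pre_digraph \<Rightarrow> bool" where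
  "hom_equivalent H G \<longleftrightarrow> H \<rightharpoonup> G \<and> G \<rightharpoonup> H"

definition relabel :: "('a \<Rightarrow> 'b) \<Rightarrow> 'a pair_pre_digraph \<Rightarrow> 'b pair_pre_digraph" where
  "relabel f G = \<lparr>pverts = f ` pverts G, parcs = map_prod f f ` parcs G\<rparr>"

definition disjoint_union ::
  "'a pair_pre_digraph \<Rightarrow> 'b pair_pre_digraph \<Rightarrow> ('a + 'b) pair_pre_digraph" where
  "disjoint_union H G =
     \<lparr>pverts = Inl ` pverts H \<union> Inr ` pverts G,
      parcs = map_prod Inl Inl ` parcs H \<union> map_prod Inr Inr ` parcs G\<rparr>"

definition finite_digraph_function ::
  "(nat pair_pre_digraph \<Rightarrow> nat pair_pre_digraph) \<Rightarrow> bool" where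
  "finite_digraph_function \<Lambda> \<longleftrightarrow> (\<forall>H. pair_fin_digraph H \<longrightarrow> pair_fin_digraph (\<Lambda> H))"

definition pcsp_reduction ::
  "(nat pair_pre_digraph \<Rightarrow> nat pair_pre_digraph) \<Rightarrow>
   nat pair_pre_digraph \<Rightarrow> nat pair_pre_digraph \<Rightarrow>
   nat pair_pre_digraph \<Rightarrow> nat pair_pre_digraph \<Rightarrow> bool" where
  "pcsp_reduction \<Lambda> H\<^sub>1 G\<^sub>1 H\<^sub>2 G\<^sub>2 \<longleftrightarrow>
     (\<forall>I. pair_fin_digraph I \<longrightarrow>
        (I \<rightharpoonup> H\<^sub>1 \<longrightarrow> \<Lambda> I \<rightharpoonup> H\<^sub>2) \<and> (\<not> I \<rightharpoonup> G\<^sub>1 \<longrightarrow> \<not> \<Lambda> I \<rightharpoonup> G\<^sub>2))"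

definition hom_monotone ::
  "(nat pair_pre_digraph \<Rightarrow> nat pair_pre_digraph) \<Rightarrow> bool" where
  "hom_monotone \<Lambda> \<longleftrightarrow>
     (\<forall>H G. pair_fin_digraph H \<longrightarrow> pair_fin_digraph G \<longrightarrow> H \<rightharpoonup> G \<longrightarrow> \<Lambda> H \<rightharpoonup> \<Lambda> G)"

text \<open>
  The bijection \<open>sum_encode\<close> only moves the disjoint union back to vertices in \<open>nat\<close>, so that
  \<open>\<Lambda>\<close> can be applied to it.
\<close>

definition preserves_disjoint_unions ::
  "(nat pair_pre_digraph \<Rightarrow> nat pair_pre_digraph) \<Rightarrow> bool" where
  "preserves_disjoint_unions \<Lambda> \<longleftrightarrow>
     (\<forall>H\<^sub>1 H\<^sub>2. pair_fin_digraph H\<^sub>1 \<longrightarrow> pair_fin_digraph H\<^sub>2 \<longrightarrow>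
        hom_equivalent (\<Lambda> (relabel sum_encode (disjoint_union H\<^sub>1 H\<^sub>2)))
                       (disjoint_union (\<Lambda> H\<^sub>1) (\<Lambda> H\<^sub>2)))"

text \<open>
  The values of \<open>\<Gamma>\<close> may be infinite digraphs. The digraph \<open>H\<close> is required to have a vertex: the
  empty digraph maps to every \<open>\<Gamma> G\<close>, whereas its image under \<open>\<Lambda>\<close> need not map to \<open>G\<close>. (The
  constant function to a single loop is monotone, preserves binary disjoint unions and reduces
  the problem of the loop to itself.) The digraph \<open>G\<close> and the values of \<open>\<Lambda>\<close> and \<open>\<Gamma>\<close> may be
  empty.
\<close>

definition right_adjoint_on_finite ::
  "(nat pair_pre_digraph \<Rightarrow> nat pair_pre_digraph) \<Rightarrow>
   (nat pair_pre_digraph \<Rightarrow> 'v pair_pre_digraph) \<Rightarrow> bool" where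
  "right_adjoint_on_finite \<Lambda> \<Gamma> \<longleftrightarrow>
     (\<forall>G. pair_fin_digraph G \<longrightarrow> pair_wf_digraph (\<Gamma> G)) \<and>
     (\<forall>H G. pair_fin_digraph H \<longrightarrow> pverts H \<noteq> {} \<longrightarrow> pair_fin_digraph G \<longrightarrow>
        (H \<rightharpoonup> \<Gamma> G \<longleftrightarrow> \<Lambda> H \<rightharpoonup> G))"

end

theory Submission
  imports Defs
begin

text \<open>
  \<open>\<Gamma> G\<close> is the disjoint union of all finite digraphs \<open>F\<close> with \<open>\<Lambda> F \<rightharpoonup> G\<close>. A nonempty finite
  digraph mapping to it meets finitely many summands only, and \<open>\<Lambda>\<close> of the disjoint union of
  these still maps to \<open>G\<close> because \<open>\<Lambda>\<close> preserves disjoint unions; monotonicity does the rest.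
  For \<open>\<Gamma> G\<^sub>2 \<rightharpoonup> G\<^sub>1\<close>, the adjunction and the reduction show that every finite subgraph of
  \<open>\<Gamma> G\<^sub>2\<close> maps to \<open>G\<^sub>1\<close>, so compactness applies, \<open>G\<^sub>1\<close> being finite.
\<close>

section \<open>Homomorphisms, relabelling and binary disjoint unions\<close>

lemma digraph_homI:
  assumes "\<And>v. v \<in> pverts H \<Longrightarrow> f v \<in> pverts G"
    and "\<And>u v. (u, v) \<in> parcs H \<Longrightarrow> (f u, f v) \<in> parcs G"
  shows "digraph_hom H G f"
  using assms by (auto simp: digraph_hom_def)

lemma digraph_hom_vertsD: "digraph_hom H G f \<Longrightarrow> v \<in> pverts H \<Longrightarrow> f v \<in> pverts G"
  by (simp add: digraph_hom_def)

lemma digraph_hom_arcsD: "digraph_hom H G f \<Longrightarrow> (u, v) \<in> parcs H \<Longrightarrow> (f u, f v) \<in> parcs G"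
  by (auto simp: digraph_hom_def)

lemma digraph_hom_comp:
  assumes "digraph_hom F G f" and "digraph_hom G H g"
  shows "digraph_hom F H (g \<circ> f)"
  using assms by (auto intro!: digraph_homI dest: digraph_hom_vertsD digraph_hom_arcsD)

lemma maps_to_trans: "F \<rightharpoonup> G \<Longrightarrow> G \<rightharpoonup> H \<Longrightarrow> F \<rightharpoonup> H"
  unfolding maps_to_def by (blast intro: digraph_hom_comp)

lemma maps_to_refl: "G \<rightharpoonup> G"
  unfolding maps_to_def by (rule exI[of _ id]) (simp add: digraph_hom_def)

lemma pair_wf_digraph_iff:
  "pair_wf_digraph G \<longleftrightarrow> (\<forall>u v. (u, v) \<in> parcs G \<longrightarrow> u \<in> pverts G \<and> v \<in> pverts G)"
  by (auto simp: pair_wf_digraph_def)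

lemma pair_fin_digraph_iff:
  "pair_fin_digraph G \<longleftrightarrow> pair_wf_digraph G \<and> finite (pverts G) \<and> finite (parcs G)"
  by (auto simp: pair_fin_digraph_def pair_fin_digraph_axioms_def)

text \<open>Without vertices a well-formed digraph has no arcs either, so every function is a
  homomorphism. This settles the vertexless cases, about which the adjunction says nothing.\<close>

lemma maps_to_empty: "pair_wf_digraph H \<Longrightarrow> pverts H = {} \<Longrightarrow> H \<rightharpoonup> G"
  by (auto simp: maps_to_def digraph_hom_def pair_wf_digraph_iff)

lemma maps_to_relabel: "G \<rightharpoonup> relabel f G"
  unfolding maps_to_def by (rule exI[of _ f]) (auto simp: digraph_hom_def relabel_def)

text \<open>The inverse of \<open>f\<close> on the vertices is a homomorphism; well-formedness puts
  both ends of every arc where this inverse undoes \<open>f\<close>.\<close>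

lemma relabel_maps_to:
  assumes "pair_wf_digraph G" and "inj_on f (pverts G)"
  shows "relabel f G \<rightharpoonup> G"
  unfolding maps_to_def
proof
  show "digraph_hom (relabel f G) G (the_inv_into (pverts G) f)"
    using assms
    by (auto intro!: digraph_homI simp: relabel_def pair_wf_digraph_iff the_inv_into_f_f)
qed

lemma pair_wf_digraph_relabel: "pair_wf_digraph G \<Longrightarrow> pair_wf_digraph (relabel f G)"
  by (auto simp: pair_wf_digraph_iff relabel_def)

lemma pair_fin_digraph_relabel: "pair_fin_digraph G \<Longrightarrow> pair_fin_digraph (relabel f G)"
  by (simp add: pair_fin_digraph_iff pair_wf_digraph_relabel) (simp add: relabel_def)

lemma pair_fin_digraph_disjoint_union:
  "pair_fin_digraph H \<Longrightarrow> pair_fin_digraph G \<Longrightarrow> pair_fin_digraph (disjoint_union H G)"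
  by (auto simp: pair_fin_digraph_iff pair_wf_digraph_iff disjoint_union_def)

lemma disjoint_union_maps_to:
  assumes "H \<rightharpoonup> K" and "G \<rightharpoonup> K"
  shows "disjoint_union H G \<rightharpoonup> K"
proof -
  obtain f g where "digraph_hom H K f" "digraph_hom G K g"
    using assms by (auto simp: maps_to_def)
  then have "digraph_hom (disjoint_union H G) K (case_sum f g)"
    by (fastforce simp: digraph_hom_def disjoint_union_def)
  then show ?thesis by (auto simp: maps_to_def)
qed

section \<open>Compactness for homomorphisms into a finite digraph\<close>

definition induced_digraph :: "'a pair_pre_digraph \<Rightarrow> 'a set \<Rightarrow> 'a pair_pre_digraph" where
  "induced_digraph H S = \<lparr>pverts = pverts H \<inter> S, parcs = parcs H \<inter> S \<times> S\<rparr>"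

lemma pair_fin_digraph_induced:
  assumes "pair_wf_digraph H" and "finite S"
  shows "pair_fin_digraph (induced_digraph H S)"
  using assms by (auto simp: pair_fin_digraph_iff pair_wf_digraph_iff induced_digraph_def)

lemma induced_digraph_maps_to: "induced_digraph H S \<rightharpoonup> H"
  unfolding maps_to_def by (rule exI[of _ id]) (auto simp: digraph_hom_def induced_digraph_def)

lemma digraph_hom_induced_mono:
  "S \<subseteq> T \<Longrightarrow> digraph_hom (induced_digraph H T) G f \<Longrightarrow> digraph_hom (induced_digraph H S) G f"
  by (auto simp: digraph_hom_def induced_digraph_def)

text \<open>
  Zorn's lemma gives a maximal set of prescribed values \<open>(v, c)\<close> that is compatible with every
  finite induced subgraph. If no value were prescribed at \<open>v\<close>, each value \<open>c\<close> would be
  obstructed by some finite set, and the union of these finitely many sets would be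
  an obstruction to the maximal set itself.
\<close>

lemma maps_to_compactness:
  fixes H :: "'a pair_pre_digraph" and G :: "'b pair_pre_digraph"
  assumes wf: "pair_wf_digraph H" and fin: "finite (pverts G)"
    and maps: "\<And>S. finite S \<Longrightarrow> S \<subseteq> pverts H \<Longrightarrow> induced_digraph H S \<rightharpoonup> G"
  shows "H \<rightharpoonup> G"
proof -
  \<comment> \<open>The prescription \<open>P\<close> is a relation, not a partial function: for
    members of \<open>\<A>\<close>, testing on \<open>S = {v}\<close> already forces at most one
    value at \<open>v\<close>.\<close>
  define ext where "ext P S f \<longleftrightarrow> digraph_hom (induced_digraph H S) G f \<and>
    (\<forall>(v, c)\<in>P. v \<in> S \<longrightarrow> f v = c)" for P S f
  define \<A> where "\<A> = {P. P \<subseteq> pverts H \<times> pverts G \<and>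
    (\<forall>S. finite S \<longrightarrow> S \<subseteq> pverts H \<longrightarrow> (\<exists>f. ext P S f))}"
  have "\<Union>C \<in> \<A>" if C: "subset.chain \<A> C" for C
  proof (cases "C = {}")
    case True
    \<comment> \<open>Here \<open>\<Union>C\<close> is empty and prescribes nothing, so membership
      in \<open>\<A>\<close> is the assumption \<open>maps\<close>.\<close>
    then show ?thesis using maps by (auto simp: \<A>_def ext_def maps_to_def)
  next
    case False
    have sub: "C \<subseteq> \<A>" using C by (simp add: subset.chain_def)
    have "\<exists>f. ext (\<Union>C) S f" if S: "finite S" "S \<subseteq> pverts H" for S
    proof -
      \<comment> \<open>Only pairs over \<open>S\<close> constrain a solution on \<open>S\<close>.
        They are finitely many because \<open>pverts G\<close> is finite, so a single member of the
        chain contains them all.\<close>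
      have "\<Union>C \<inter> S \<times> UNIV \<subseteq> S \<times> pverts G" using sub by (auto simp: \<A>_def)
      then have "finite (\<Union>C \<inter> S \<times> UNIV)"
        using S fin by (meson finite_SigmaI finite_subset)
      then obtain P where P: "P \<in> C" "\<Union>C \<inter> S \<times> UNIV \<subseteq> P"
        using finite_subset_Union_chain[OF _ _ False C] by (metis inf_le1)
      then obtain f where "ext P S f" using sub S unfolding \<A>_def by blast
      moreover have "(v, c) \<in> P" if "(v, c) \<in> \<Union>C" "v \<in> S" for v c
        using that P(2) by auto
      ultimately have "ext (\<Union>C) S f" unfolding ext_def by fast
      then show ?thesis by blast
    qed
    moreover have "\<Union>C \<subseteq> pverts H \<times> pverts G" using sub by (auto simp: \<A>_def)
    ultimately show ?thesis by (auto simp: \<A>_def)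
  qed
  then obtain M where M: "M \<in> \<A>" and max: "\<And>X. X \<in> \<A> \<Longrightarrow> M \<subseteq> X \<Longrightarrow> X = M"
    using subset_Zorn'[of \<A>] by blast
  have ext_M: "\<exists>f. ext M S f" if "finite S" "S \<subseteq> pverts H" for S
    using M that by (auto simp: \<A>_def)
  have total: "\<exists>c. (v, c) \<in> M" if v: "v \<in> pverts H" for v
  proof (rule ccontr)
    assume none: "\<nexists>c. (v, c) \<in> M"
    have "\<exists>S. finite S \<and> S \<subseteq> pverts H \<and> (\<nexists>f. ext (insert (v, c) M) S f)"
      if c: "c \<in> pverts G" for c
    proof -
      have "insert (v, c) M \<notin> \<A>" using max[of "insert (v, c) M"] none by blast
      moreover have "insert (v, c) M \<subseteq> pverts H \<times> pverts G"
        using M v c by (auto simp: \<A>_def)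
      ultimately show ?thesis by (auto simp: \<A>_def)
    qed
    then obtain S where S: "\<And>c. c \<in> pverts G \<Longrightarrow> finite (S c)"
      "\<And>c. c \<in> pverts G \<Longrightarrow> S c \<subseteq> pverts H"
      "\<And>c f. c \<in> pverts G \<Longrightarrow> \<not> ext (insert (v, c) M) (S c) f"
      by metis
    \<comment> \<open>Inserting \<open>v\<close> forces \<open>f v\<close> into
      \<open>pverts G\<close>, even if the union is empty. The obstruction chosen for the value
      \<open>f v\<close> then contradicts \<open>f\<close> itself.\<close>
    define T where "T = insert v (\<Union>c\<in>pverts G. S c)"
    have "finite T" "T \<subseteq> pverts H" using S fin v by (auto simp: T_def)
    then obtain f where f: "ext M T f" using ext_M by blast
    have fv: "f v \<in> pverts G"
      using f v by (auto simp: ext_def T_def digraph_hom_def induced_digraph_def)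
    then have "S (f v) \<subseteq> T" by (auto simp: T_def)
    then have "ext (insert (v, f v) M) (S (f v)) f"
      using f by (auto simp: ext_def intro: digraph_hom_induced_mono)
    then show False using S(3) fv by blast
  qed
  define h where "h v = (SOME c. (v, c) \<in> M)" for v
  have h: "(v, h v) \<in> M" if "v \<in> pverts H" for v
    unfolding h_def using total[OF that] by (rule someI_ex)
  have "digraph_hom H G h"
  proof (rule digraph_homI)
    fix v assume "v \<in> pverts H"
    then show "h v \<in> pverts G" using h M by (auto simp: \<A>_def)
  next
    fix u v assume uv: "(u, v) \<in> parcs H"
    then have verts: "u \<in> pverts H" "v \<in> pverts H" using wf by (auto simp: pair_wf_digraph_iff)
    \<comment> \<open>An arc involves at most two vertices, so a partial solution on its ends
      suffices; there it must agree with \<open>h\<close>.\<close>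
    then obtain f where f: "ext M {u, v} f" using ext_M[of "{u, v}"] by auto
    then have "f u = h u" "f v = h v" using h[OF verts(1)] h[OF verts(2)]
      by (auto simp: ext_def)
    moreover have "(f u, f v) \<in> parcs G"
      using f uv by (auto simp: ext_def digraph_hom_def induced_digraph_def)
    ultimately show "(h u, h v) \<in> parcs G" by simp
  qed
  then show ?thesis by (auto simp: maps_to_def)
qed

section \<open>Coproducts of sets of digraphs\<close>

text \<open>Each summand serves as its own index, which keeps the copies disjoint without a separate
  index type.\<close>

definition coproduct :: "'a pair_pre_digraph set \<Rightarrow> ('a pair_pre_digraph \<times> 'a) pair_pre_digraph"
  where "coproduct \<F> =
     \<lparr>pverts = {(F, v). F \<in> \<F> \<and> v \<in> pverts F},
      parcs = {((F, u), (F', v)). F = F' \<and> F \<in> \<F> \<and> (u, v) \<in> parcs F}\<rparr>"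

lemma pair_wf_digraph_coproduct:
  "(\<And>F. F \<in> \<F> \<Longrightarrow> pair_wf_digraph F) \<Longrightarrow> pair_wf_digraph (coproduct \<F>)"
  by (auto simp: pair_wf_digraph_iff coproduct_def)

lemma maps_to_coproduct: "F \<in> \<F> \<Longrightarrow> F \<rightharpoonup> coproduct \<F>"
  unfolding maps_to_def by (rule exI[of _ "Pair F"]) (auto simp: digraph_hom_def coproduct_def)

lemma coproduct_singleton_maps_to: "coproduct {F} \<rightharpoonup> F"
  unfolding maps_to_def by (rule exI[of _ snd]) (auto simp: digraph_hom_def coproduct_def)

text \<open>The copy of \<open>F\<close> goes to the left summand, and every other copy follows the
  given homomorphism into \<open>U\<close>.\<close>

lemma coproduct_insert_maps_to:
  assumes "coproduct \<F> \<rightharpoonup> U"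
  shows "coproduct (insert F \<F>) \<rightharpoonup> disjoint_union F U"
proof -
  obtain g where "digraph_hom (coproduct \<F>) U g" using assms by (auto simp: maps_to_def)
  then have "digraph_hom (coproduct (insert F \<F>)) (disjoint_union F U)
      (\<lambda>(K, v). if K = F then Inl v else Inr (g (K, v)))"
    by (fastforce intro!: digraph_homI simp: coproduct_def disjoint_union_def digraph_hom_def)
  then show ?thesis by (auto simp: maps_to_def)
qed

text \<open>Keep just the summands hit by vertices of \<open>H\<close>. A vertex of \<open>H\<close>
  makes this family nonempty, as the induction building an upper bound requires.\<close>

lemma maps_to_finite_coproduct:
  assumes wf: "pair_wf_digraph H" and fin: "finite (pverts H)" and ne: "pverts H \<noteq> {}"
    and maps: "H \<rightharpoonup> coproduct \<F>"
  obtains \<F>' where "finite \<F>'" "\<F>' \<noteq> {}" "\<F>' \<subseteq> \<F>" "H \<rightharpoonup> coproduct \<F>'"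
proof -
  obtain f where f: "digraph_hom H (coproduct \<F>) f" using maps by (auto simp: maps_to_def)
  define \<F>' where "\<F>' = (fst \<circ> f) ` pverts H"
  have "digraph_hom H (coproduct \<F>') f"
  proof (rule digraph_homI)
    fix v assume v: "v \<in> pverts H"
    then have "f v \<in> pverts (coproduct \<F>)" using f by (rule digraph_hom_vertsD[rotated])
    moreover have "fst (f v) \<in> \<F>'" using v by (simp add: \<F>'_def)
    ultimately show "f v \<in> pverts (coproduct \<F>')" by (auto simp: coproduct_def)
  next
    fix u v assume uv: "(u, v) \<in> parcs H"
    then have "(f u, f v) \<in> parcs (coproduct \<F>)" using f by (rule digraph_hom_arcsD[rotated])
    moreover have "fst (f u) \<in> \<F>'" using uv wf by (auto simp: \<F>'_def pair_wf_digraph_iff)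
    ultimately show "(f u, f v) \<in> parcs (coproduct \<F>')" by (auto simp: coproduct_def)
  qed
  moreover have "\<F>' \<subseteq> \<F>"
    using f by (auto simp: \<F>'_def coproduct_def dest!: digraph_hom_vertsD)
  ultimately show thesis
    using that[of \<F>'] fin ne by (auto simp: \<F>'_def maps_to_def)
qed

text \<open>Vertex set and arc set are coded separately, arcs first becoming numbers. Finiteness is
  essential, as \<open>set_encode\<close> separates only finite sets.\<close>

lemma inj_on_finite_digraph_code:
  "inj_on (\<lambda>F. prod_encode (set_encode (pverts F), set_encode (prod_encode ` parcs F)))
     {F :: nat pair_pre_digraph. pair_fin_digraph F}"
  by (rule inj_onI)
    (auto intro!: pair_pre_digraph.equality
      simp: pair_fin_digraph_iff set_encode_eq inj_image_eq_iff[OF inj_prod_encode])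

text \<open>Keeping the vertices in \<open>nat\<close> requires numbering the finite digraphs on \<open>nat\<close>.\<close>

lemma coproduct_nat_representation:
  fixes \<F> :: "nat pair_pre_digraph set"
  assumes fin: "\<And>F. F \<in> \<F> \<Longrightarrow> pair_fin_digraph F"
  obtains K :: "nat pair_pre_digraph"
  where "pair_wf_digraph K" "K \<rightharpoonup> coproduct \<F>" "coproduct \<F> \<rightharpoonup> K"
proof -
  obtain code :: "nat pair_pre_digraph \<Rightarrow> nat" where "inj_on code {F. pair_fin_digraph F}"
    using inj_on_finite_digraph_code by blast
  \<comment> \<open>The code of the summand is the first component of the new vertex name, so copies
    of different summands stay disjoint.\<close>
  then have inj: "inj_on (\<lambda>(F, v). prod_encode (code F, v)) (pverts (coproduct \<F>))"
    using fin by (auto simp: inj_on_def coproduct_def)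
  have "pair_wf_digraph (coproduct \<F>)"
    using fin by (intro pair_wf_digraph_coproduct) (simp add: pair_fin_digraph_iff)
  then show thesis
    using that[OF pair_wf_digraph_relabel relabel_maps_to[OF _ inj] maps_to_relabel] by blast
qed

section \<open>Construction of the right adjoint\<close>

text \<open>Members are added one at a time by disjoint union, whose image under
  \<open>\<Lambda>\<close> maps to \<open>G\<close> whenever both parts do. The induction starts at
  one member, since \<open>\<Lambda>\<close> of the empty digraph need not map to
  \<open>G\<close>.\<close>

lemma finite_coproduct_upper_bound:
  assumes union: "preserves_disjoint_unions \<Lambda>"
    and "finite \<F>" "\<F> \<noteq> {}" "\<And>F. F \<in> \<F> \<Longrightarrow> pair_fin_digraph F \<and> \<Lambda> F \<rightharpoonup> G"
  shows "\<exists>U. pair_fin_digraph U \<and> \<Lambda> U \<rightharpoonup> G \<and> coproduct \<F> \<rightharpoonup> U"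
  using assms(2-)
proof (induction rule: finite_ne_induct)
  case (singleton F)
  then show ?case using coproduct_singleton_maps_to by blast
next
  case (insert F \<F>)
  then obtain U where U: "pair_fin_digraph U" "\<Lambda> U \<rightharpoonup> G" "coproduct \<F> \<rightharpoonup> U" by blast
  have F: "pair_fin_digraph F" "\<Lambda> F \<rightharpoonup> G" using insert.prems by auto
  let ?W = "relabel sum_encode (disjoint_union F U)"
  have "\<Lambda> ?W \<rightharpoonup> disjoint_union (\<Lambda> F) (\<Lambda> U)"
    using union F U by (simp add: preserves_disjoint_unions_def hom_equivalent_def)
  then have "\<Lambda> ?W \<rightharpoonup> G"
    using disjoint_union_maps_to[OF F(2) U(2)] by (rule maps_to_trans)
  moreover have "coproduct (insert F \<F>) \<rightharpoonup> ?W"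
    using coproduct_insert_maps_to[OF U(3)] maps_to_relabel by (rule maps_to_trans)
  moreover have "pair_fin_digraph ?W"
    using F U by (intro pair_fin_digraph_relabel pair_fin_digraph_disjoint_union)
  ultimately show ?case by blast
qed

lemma right_adjoint_on_finite_exists:
  assumes mono: "hom_monotone \<Lambda>" and union: "preserves_disjoint_unions \<Lambda>"
  shows "\<exists>\<Gamma> :: nat pair_pre_digraph \<Rightarrow> nat pair_pre_digraph. right_adjoint_on_finite \<Lambda> \<Gamma>"
proof -
  define \<F> where "\<F> G = {F. pair_fin_digraph F \<and> \<Lambda> F \<rightharpoonup> G}" for G :: "nat pair_pre_digraph"
  \<comment> \<open>The adjunction depends on \<open>\<Gamma> G\<close> only up to homomorphic
    equivalence, so a copy on \<open>nat\<close> can replace the coproduct.\<close>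
  have "\<exists>K :: nat pair_pre_digraph. pair_wf_digraph K \<and> K \<rightharpoonup> coproduct (\<F> G) \<and>
      coproduct (\<F> G) \<rightharpoonup> K" for G
    by (rule coproduct_nat_representation[of "\<F> G"]) (auto simp: \<F>_def)
  then obtain \<Gamma> :: "nat pair_pre_digraph \<Rightarrow> nat pair_pre_digraph" where
    \<Gamma>: "\<And>G. pair_wf_digraph (\<Gamma> G)" "\<And>G. \<Gamma> G \<rightharpoonup> coproduct (\<F> G)"
      "\<And>G. coproduct (\<F> G) \<rightharpoonup> \<Gamma> G"
    by metis
  have "H \<rightharpoonup> \<Gamma> G \<longleftrightarrow> \<Lambda> H \<rightharpoonup> G" if H: "pair_fin_digraph H" and ne: "pverts H \<noteq> {}" for H G
  proof
    assume "\<Lambda> H \<rightharpoonup> G"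
    then have "H \<rightharpoonup> coproduct (\<F> G)" using H by (intro maps_to_coproduct) (simp add: \<F>_def)
    then show "H \<rightharpoonup> \<Gamma> G" using \<Gamma>(3) by (rule maps_to_trans)
  next
    assume "H \<rightharpoonup> \<Gamma> G"
    then have "H \<rightharpoonup> coproduct (\<F> G)" using \<Gamma>(2) by (rule maps_to_trans)
    then obtain \<F>' where \<F>': "finite \<F>'" "\<F>' \<noteq> {}" "\<F>' \<subseteq> \<F> G" "H \<rightharpoonup> coproduct \<F>'"
      using maps_to_finite_coproduct H ne by (metis pair_fin_digraph_iff)
    then obtain U where U: "pair_fin_digraph U" "\<Lambda> U \<rightharpoonup> G" "coproduct \<F>' \<rightharpoonup> U"
      using finite_coproduct_upper_bound[OF union, of \<F>' G] by (auto simp: \<F>_def)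
    have "H \<rightharpoonup> U" using \<F>'(4) U(3) by (rule maps_to_trans)
    then have "\<Lambda> H \<rightharpoonup> \<Lambda> U" using mono H U by (simp add: hom_monotone_def)
    then show "\<Lambda> H \<rightharpoonup> G" using U(2) by (rule maps_to_trans)
  qed
  then have "right_adjoint_on_finite \<Lambda> \<Gamma>"
    using \<Gamma>(1) by (simp add: right_adjoint_on_finite_def)
  then show ?thesis by blast
qed

section \<open>Comparison of an arbitrary right adjoint with the templates\<close>

lemma right_adjoint_on_finite_maps_to:
  fixes \<Gamma> :: "nat pair_pre_digraph \<Rightarrow> 'v pair_pre_digraph"
  assumes adj: "right_adjoint_on_finite \<Lambda> \<Gamma>" and red: "pcsp_reduction \<Lambda> H\<^sub>1 G\<^sub>1 H\<^sub>2 G\<^sub>2"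
    and G\<^sub>1: "pair_fin_digraph G\<^sub>1" and G\<^sub>2: "pair_fin_digraph G\<^sub>2"
  shows "\<Gamma> G\<^sub>2 \<rightharpoonup> G\<^sub>1"
proof (rule maps_to_compactness)
  show wf: "pair_wf_digraph (\<Gamma> G\<^sub>2)" using adj G\<^sub>2 by (simp add: right_adjoint_on_finite_def)
  show "finite (pverts G\<^sub>1)" using G\<^sub>1 by (simp add: pair_fin_digraph_iff)
  fix S assume S: "finite S" "S \<subseteq> pverts (\<Gamma> G\<^sub>2)"
  let ?D = "induced_digraph (\<Gamma> G\<^sub>2) S"
  have D: "pair_fin_digraph ?D" using wf S(1) by (rule pair_fin_digraph_induced)
  show "?D \<rightharpoonup> G\<^sub>1"
  proof (cases "pverts ?D = {}")
    case True
    then show ?thesis using D by (simp add: maps_to_empty pair_fin_digraph_iff)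
  next
    case False
    \<comment> \<open>The adjunction and the reduction speak of digraphs on \<open>nat\<close>,
      while \<open>\<Gamma> G\<^sub>2\<close> lives on an arbitrary type; its finite pieces can be
      renumbered.\<close>
    obtain e :: "'v \<Rightarrow> nat" where e: "inj_on e (pverts ?D)"
      using D finite_imp_inj_to_nat_seg by (metis pair_fin_digraph_iff)
    let ?E = "relabel e ?D"
    have E: "pair_fin_digraph ?E" using D by (rule pair_fin_digraph_relabel)
    have "?E \<rightharpoonup> ?D" using D e by (simp add: relabel_maps_to pair_fin_digraph_iff)
    then have "?E \<rightharpoonup> \<Gamma> G\<^sub>2" using induced_digraph_maps_to by (rule maps_to_trans)
    moreover have "pverts ?E \<noteq> {}" using False by (simp add: relabel_def)
    ultimately have "\<Lambda> ?E \<rightharpoonup> G\<^sub>2" using adj E G\<^sub>2 by (simp add: right_adjoint_on_finite_def)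
    \<comment> \<open>This is the contrapositive of the NO condition of the reduction.\<close>
    then have "?E \<rightharpoonup> G\<^sub>1" using red E by (auto simp: pcsp_reduction_def)
    with maps_to_relabel show ?thesis by (rule maps_to_trans)
  qed
qed

theorem theorem4p8:
  fixes H\<^sub>1 G\<^sub>1 H\<^sub>2 G\<^sub>2 :: "nat pair_pre_digraph"
    and \<Lambda> :: "nat pair_pre_digraph \<Rightarrow> nat pair_pre_digraph"
  assumes "pair_fin_digraph H\<^sub>1" and "pair_fin_digraph G\<^sub>1"
    and "pair_fin_digraph H\<^sub>2" and "pair_fin_digraph G\<^sub>2"
    and "H\<^sub>1 \<rightharpoonup> G\<^sub>1" and "H\<^sub>2 \<rightharpoonup> G\<^sub>2"
    and "finite_digraph_function \<Lambda>"
    and "pcsp_reduction \<Lambda> H\<^sub>1 G\<^sub>1 H\<^sub>2 G\<^sub>2"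
    and "hom_monotone \<Lambda>"
    and "preserves_disjoint_unions \<Lambda>"
  shows "(\<exists>\<Gamma> :: nat pair_pre_digraph \<Rightarrow> nat pair_pre_digraph. right_adjoint_on_finite \<Lambda> \<Gamma>)
    \<and> (\<forall>\<Gamma> :: nat pair_pre_digraph \<Rightarrow> 'v pair_pre_digraph.
          right_adjoint_on_finite \<Lambda> \<Gamma> \<longrightarrow> H\<^sub>1 \<rightharpoonup> \<Gamma> H\<^sub>2 \<and> \<Gamma> G\<^sub>2 \<rightharpoonup> G\<^sub>1)"
proof (intro conjI allI impI)
  show "\<exists>\<Gamma> :: nat pair_pre_digraph \<Rightarrow> nat pair_pre_digraph. right_adjoint_on_finite \<Lambda> \<Gamma>"
    using assms by (intro right_adjoint_on_finite_exists)
next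
  fix \<Gamma> :: "nat pair_pre_digraph \<Rightarrow> 'v pair_pre_digraph"
  assume adj: "right_adjoint_on_finite \<Lambda> \<Gamma>"
  show "\<Gamma> G\<^sub>2 \<rightharpoonup> G\<^sub>1" using adj assms by (intro right_adjoint_on_finite_maps_to)
  show "H\<^sub>1 \<rightharpoonup> \<Gamma> H\<^sub>2"
  proof (cases "pverts H\<^sub>1 = {}")
    case True
    then show ?thesis using assms by (simp add: maps_to_empty pair_fin_digraph_iff)
  next
    case False
    \<comment> \<open>The YES condition is applied to the instance \<open>H\<^sub>1\<close> itself,
      with the identity as homomorphism; the adjunction then transposes the result.\<close>
    have "\<Lambda> H\<^sub>1 \<rightharpoonup> H\<^sub>2" using assms maps_to_refl by (auto simp: pcsp_reduction_def)
    then show ?thesis using adj assms False by (simp add: right_adjoint_on_finite_def)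
  qed
qed

end
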